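(* Let $c,d$ be integers with $2\le c<d$, let $\mathbb{T}_{c,d}$ be the $(c,d)$-biregular tree rooted at a vertex $o$, and let $\emptyset\ne S\subseteq V(\mathbb{T}_{c,d})$ be an arbitrary non-empty subset of its vertices. Let $\alpha(S)=\limsup_{t\to\infty}a_t(S)^{1/t}$ and $\beta(S)=\limsup_{t\to\infty}b_t(S)^{1/t}$. Then $$\beta(S)=\begin{cases}\sqrt{c-1}+\sqrt{d-1} & \text{if } \alpha(S)\le[(c-1)(d-1)]^{1/4},\\ \sqrt{\alpha(S)^2+c+d-2+\frac{(c-1)(d-1)}{\alpha(S)^2}} & \text{if } \alpha(S)\ge[(c-1)(d-1)]^{1/4}.\end{cases}$$
   Context: The $(c,d)$-biregular tree $\mathbb{T}_{c,d}$ is the infinite tree all of whose vertices have degree $c$ or $d$, where every vertex of degree $d$ has all its neighbors of degree $c$, and vice versa. The root $o$ is an arbitrary fixed vertex. $a_t(S)$ is the number of non-backtracking walks of length $t$ in $\mathbb{T}_{c,d}$ that begin at $o$ and end in $S$ (equivalently, the number of elements of $S$ at distance $t$ from $o$), and $b_t(S)$ is the number of arbitrary (not necessarily non-backtracking) walks of length $t$ that begin at $o$ and end in $S$. *)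

theory Defs
  imports Complex_Main "HOL-Library.Extended_Real"
begin

text \<open>A simple graph is a vertex set together with a symmetric irreflexive adjacency relation;
  both may be infinite.\<close>

definition simple_graph :: "'a set \<Rightarrow> ('a \<times> 'a) set \<Rightarrow> bool" where
  "simple_graph V E \<longleftrightarrow> E \<subseteq> V \<times> V \<and> sym E \<and> irrefl E"

text \<open>A walk is given by its non-empty list of vertices; its length is the number of steps,
  i.e. one less than the length of the list.\<close>

definition graph_walk :: "'a set \<Rightarrow> ('a \<times> 'a) set \<Rightarrow> 'a list \<Rightarrow> bool" where
  "graph_walk V E p \<longleftrightarrow> p \<noteq> [] \<and> set p \<subseteq> V \<and> successively (\<lambda>x y. (x, y) \<in> E) p"

definition nonbacktracking :: "'a list \<Rightarrow> bool" where
  "nonbacktracking p \<longleftrightarrow> (\<forall>i. i + 2 < length p \<longrightarrow> p ! i \<noteq> p ! (i + 2))"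

definition graph_connected :: "'a set \<Rightarrow> ('a \<times> 'a) set \<Rightarrow> bool" where
  "graph_connected V E \<longleftrightarrow>
     (\<forall>u\<in>V. \<forall>v\<in>V. \<exists>p. graph_walk V E p \<and> hd p = u \<and> last p = v)"

definition graph_cycle :: "'a set \<Rightarrow> ('a \<times> 'a) set \<Rightarrow> 'a list \<Rightarrow> bool" where
  "graph_cycle V E p \<longleftrightarrow>
     graph_walk V E p \<and> distinct p \<and> 3 \<le> length p \<and> (last p, hd p) \<in> E"

definition graph_tree :: "'a set \<Rightarrow> ('a \<times> 'a) set \<Rightarrow> bool" where
  "graph_tree V E \<longleftrightarrow>
     simple_graph V E \<and> V \<noteq> {} \<and> graph_connected V E \<and> (\<nexists>p. graph_cycle V E p)"

text \<open>Since \<open>card\<close> of an infinite set is 0, a positive degree means that the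
  neighbourhood is finite.\<close>

definition graph_degree :: "('a \<times> 'a) set \<Rightarrow> 'a \<Rightarrow> nat" where
  "graph_degree E v = card (E `` {v})"

text \<open>For \<open>c, d \<ge> 2\<close> this determines the graph up to isomorphism.\<close>

definition biregular_tree :: "nat \<Rightarrow> nat \<Rightarrow> 'a set \<Rightarrow> ('a \<times> 'a) set \<Rightarrow> bool" where
  "biregular_tree c d V E \<longleftrightarrow>
     graph_tree V E \<and> infinite V \<and>
     (\<forall>v\<in>V. graph_degree E v = c \<or> graph_degree E v = d) \<and>
     (\<forall>v\<in>V. graph_degree E v = d \<longrightarrow> (\<forall>w\<in>E `` {v}. graph_degree E w = c)) \<and>
     (\<forall>v\<in>V. graph_degree E v = c \<longrightarrow> (\<forall>w\<in>E `` {v}. graph_degree E w = d))"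

text \<open>The root \<open>r\<close> is the vertex called \<open>o\<close> in the literature.\<close>

definition nb_walk_count ::
  "'a set \<Rightarrow> ('a \<times> 'a) set \<Rightarrow> 'a \<Rightarrow> 'a set \<Rightarrow> nat \<Rightarrow> nat" where
  "nb_walk_count V E r S t =
     card {p. graph_walk V E p \<and> nonbacktracking p \<and> length p = t + 1 \<and> hd p = r \<and> last p \<in> S}"

definition walk_count ::
  "'a set \<Rightarrow> ('a \<times> 'a) set \<Rightarrow> 'a \<Rightarrow> 'a set \<Rightarrow> nat \<Rightarrow> nat" where
  "walk_count V E r S t =
     card {p. graph_walk V E p \<and> length p = t + 1 \<and> hd p = r \<and> last p \<in> S}"

text \<open>The rate \<open>limsup n\<^sub>t\<^bsup>1/t\<^esup>\<close> is taken in the extended reals, so that no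
  finiteness is presupposed.\<close>

definition growth_rate :: "(nat \<Rightarrow> nat) \<Rightarrow> ereal" where
  "growth_rate n = limsup (\<lambda>t. ereal (real (n t) powr (1 / real t)))"

end

theory Submission
  imports Defs
begin

text \<open>A vertex at distance \<open>k\<close> from the root is reached by the same number \<open>W t k\<close> of walks of
  length \<open>t\<close> as any other such vertex, so \<open>b\<^sub>t(S) = (\<Sum>k\<le>t. a\<^sub>k(S) * W t k)\<close>. Write
  \<open>p = deg r - 1\<close>, \<open>q\<close> for the other branching number and
  \<open>\<Lambda>(\<mu>) = sqrt (\<mu>\<^sup>2 + p + q + p * q / \<mu>\<^sup>2)\<close>, which increases from \<open>\<mu> = (p * q) powr (1 / 4)\<close> on.
  For \<open>\<mu> \<ge> 1\<close> the weights \<open>1 / \<mu> ^ k\<close>, corrected by a factor depending on the parity of \<open>k\<close>, form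
  a supersolution, whence \<open>W t k \<le> C * \<Lambda>(\<mu>) ^ t / \<mu> ^ k\<close> and the upper bound on \<open>\<beta>\<close>.
  For the lower bound let \<open>\<Lambda> > \<beta>\<close>. Then \<open>G k = (\<Sum>t. W t k / \<Lambda> ^ t)\<close> is finite and positive and
  solves \<open>G k + p * q * G (k + 4) = (\<Lambda>\<^sup>2 - p - q) * G (k + 2)\<close>. A positive solution exists only if
  \<open>\<Lambda> = \<Lambda>(\<mu>)\<close> for some \<open>\<mu> \<ge> (p * q) powr (1 / 4)\<close>, and it decays no faster than \<open>1 / \<mu> ^ k\<close>;
  since \<open>a\<^sub>k(S) * G k\<close> is bounded, \<open>\<alpha> \<le> \<mu>\<close>.\<close>

subsection \<open>Growth rates\<close>

lemma growth_rate_nonneg: "0 \<le> growth_rate n"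
  unfolding growth_rate_def by (intro le_Limsup) auto

lemma growth_rate_le:
  assumes "\<And>t. real (n t) \<le> K * y ^ t" and "0 < y"
  shows "growth_rate n \<le> ereal y"
proof -
  \<comment> \<open>\<open>K\<close> may be 0, whereas the \<open>t\<close>-th root of
    \<open>max K 1\<close> always tends to 1.\<close>
  have K: "0 < max K 1" by simp
  have "(\<lambda>t. max K 1 powr (1 / real t)) \<longlonglongrightarrow> max K 1 powr 0"
    by (intro tendsto_intros lim_1_over_n) simp
  then have lim: "(\<lambda>t. ereal (max K 1 powr (1 / real t) * y)) \<longlonglongrightarrow> ereal y"
    using K tendsto_mult_right[of _ 1 _ y] by (auto simp del: max_less_iff_conj)
  have bound: "real (n t) powr (1 / real t) \<le> max K 1 powr (1 / real t) * y" if "0 < t" for t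
  proof -
    have "real (n t) \<le> max K 1 * y ^ t"
      by (rule order_trans[OF assms(1)]) (use assms(2) in \<open>auto intro: mult_right_mono\<close>)
    then have "real (n t) powr (1 / real t) \<le> (max K 1 * y ^ t) powr (1 / real t)"
      by (intro powr_mono2) auto
    also have "\<dots> = max K 1 powr (1 / real t) * y"
      using assms(2) that by (simp add: powr_mult powr_realpow[symmetric] powr_powr)
    finally show ?thesis .
  qed
  have "growth_rate n \<le> limsup (\<lambda>t. ereal (max K 1 powr (1 / real t) * y))"
    unfolding growth_rate_def
    by (intro Limsup_mono eventually_mono[OF eventually_gt_at_top[of 0]]) (use bound in auto)
  also have "\<dots> = ereal y"
    by (intro lim_imp_Limsup lim) simp
  finally show ?thesis .
qed

lemma growth_rate_lessE:
  assumes "growth_rate n < ereal y"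
  obtains K where "0 < K" and "\<And>t. real (n t) \<le> K * y ^ t"
proof -
  have y: "0 < y"
    using assms growth_rate_nonneg[of n] by (metis ereal_less(2) le_less_trans)
  from assms obtain N where N: "\<And>t. N \<le> t \<Longrightarrow> real (n t) powr (1 / real t) < y"
    unfolding growth_rate_def by (force dest!: Limsup_lessD simp: eventually_sequentially)
  \<comment> \<open>Beyond \<open>N\<close> the constant 1 suffices. The sum absorbs the finitely
    many earlier terms, among them \<open>t = 0\<close>, where the exponent
    \<open>1 / real t\<close> is meaningless.\<close>
  define K where "K = 1 + (\<Sum>t\<le>N. real (n t) / y ^ t)"
  have "1 \<le> K" unfolding K_def using y by (simp add: sum_nonneg)
  moreover have "real (n t) \<le> K * y ^ t" for t
  proof (cases "t \<le> N")
    case True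
    then have "real (n t) / y ^ t \<le> (\<Sum>t\<le>N. real (n t) / y ^ t)"
      using y by (intro member_le_sum) auto
    then have "real (n t) / y ^ t \<le> K" unfolding K_def by simp
    then show ?thesis using y by (simp add: field_simps)
  next
    case False
    then have t: "0 < t" "real (n t) powr (1 / real t) < y" using N by auto
    then have "(real (n t) powr (1 / real t)) ^ t \<le> y ^ t"
      by (intro power_mono) auto
    moreover have "(real (n t) powr (1 / real t)) ^ t = real (n t)"
      using t(1) by (cases "n t = 0") (simp_all add: powr_realpow[symmetric] powr_powr)
    ultimately have "real (n t) \<le> 1 * y ^ t" by simp
    also have "\<dots> \<le> K * y ^ t" using y \<open>1 \<le> K\<close> by (intro mult_right_mono) auto
    finally show ?thesis .
  qed
  ultimately show ?thesis by (intro that[of K]) auto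
qed

subsection \<open>Positive solutions of a three-term recurrence\<close>

text \<open>The step from \<open>x = R j\<close> to \<open>R (Suc j)\<close> is a drop by
  \<open>(Q * x\<^sup>2 - M * x + 1) / (Q * x)\<close>. A numerator bounded away from 0 would push
  the sequence below 0.\<close>

lemma no_uniform_descent:
  fixes R :: "nat \<Rightarrow> real"
  assumes "\<And>j. 0 < R j" and "0 < Q" and "\<And>j. 1 / R j + Q * R (Suc j) = M"
    and "0 < \<delta>" and gap: "\<And>x. 0 < x \<Longrightarrow> x \<le> R 0 \<Longrightarrow> \<delta> \<le> Q * x\<^sup>2 - M * x + 1"
  shows False
proof -
  \<comment> \<open>A lower bound for every drop: the numerator is at least \<open>\<delta>\<close>,
    the denominator at most \<open>Q * R 0\<close>.\<close>
  define e where "e = \<delta> / (Q * R 0)"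
  have "0 < e" unfolding e_def using assms by simp
  have "R j \<le> R 0 - real j * e" for j
  proof (induction j)
    case (Suc j)
    have "0 \<le> real j * e" using \<open>0 < e\<close> by simp
    with Suc have le: "R j \<le> R 0" by linarith
    have R: "R j - R (Suc j) = (Q * (R j)\<^sup>2 - M * R j + 1) / (Q * R j)"
      using assms(1)[of j] \<open>0 < Q\<close> assms(3)[of j, symmetric]
      by (simp add: field_simps power2_eq_square)
    have "e \<le> R j - R (Suc j)"
      unfolding R e_def using assms(1,2,4) gap[OF assms(1) le] le
      by (intro frac_le mult_left_mono) (auto simp: less_imp_le)
    with Suc show ?case by (simp add: algebra_simps)
  qed simp
  moreover obtain j where "R 0 < real j * e"
    using reals_Archimedean3[OF \<open>0 < e\<close>] by blast
  ultimately show False using assms(1)[of j] by (smt (verit))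
qed

text \<open>If the characteristic polynomial \<open>Q * x\<^sup>2 - M * x + 1\<close> had no real
  root, or if some ratio of consecutive terms lay below its smaller root, the ratios would descend
  uniformly. The roots have product \<open>1 / Q\<close>, so
  \<open>Q * \<rho>\<^sup>2 \<le> 1\<close> marks the smaller one.\<close>

lemma positive_recurrence_growth:
  fixes g :: "nat \<Rightarrow> real"
  assumes pos: "\<And>j. 0 < g j" and "0 < Q" and rec: "\<And>j. g j + Q * g (j + 2) = M * g (j + 1)"
  obtains \<rho> where "0 < \<rho>" and "Q * \<rho>\<^sup>2 - M * \<rho> + 1 = 0" and "Q * \<rho>\<^sup>2 \<le> 1"
    and "\<And>j. \<rho> * g j \<le> g (Suc j)"
proof -
  \<comment> \<open>The offset \<open>i\<close> lets the descent argument start at any term.\<close>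
  define R where "R i j = g (Suc (i + j)) / g (i + j)" for i j
  have R0: "0 < R i j" for i j unfolding R_def using pos by simp
  have R: "1 / R i j + Q * R i (Suc j) = M" for i j
    unfolding R_def using rec[of "i + j"] pos[of "i + j"] pos[of "Suc (i + j)"]
    by (simp add: field_simps)
  have "0 < M"
    using R[of 0 0] R0[of 0 0] R0[of 0 "Suc 0"] \<open>0 < Q\<close>
    by (metis add_pos_pos divide_pos_pos mult_pos_pos zero_less_one)
  have sq: "Q * x\<^sup>2 - M * x + 1 = Q * (x - M / (2 * Q))\<^sup>2 + (1 - M\<^sup>2 / (4 * Q))" for x
    using \<open>0 < Q\<close> by (simp add: field_simps power2_eq_square)
  have disc: "4 * Q \<le> M\<^sup>2"
  proof (rule ccontr)
    assume "\<not> ?thesis"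
    then have "0 < 1 - M\<^sup>2 / (4 * Q)" using \<open>0 < Q\<close> by (simp add: field_simps)
    moreover have "1 - M\<^sup>2 / (4 * Q) \<le> Q * x\<^sup>2 - M * x + 1" for x
      unfolding sq using \<open>0 < Q\<close> by simp
    ultimately show False using no_uniform_descent[of "R 0", OF R0 \<open>0 < Q\<close> R] by blast
  qed
  define s where "s = sqrt (M\<^sup>2 - 4 * Q)"
  \<comment> \<open>The smaller root; \<open>s / Q\<close> is the gap to the larger one.\<close>
  define \<rho> where "\<rho> = (M - s) / (2 * Q)"
  have s2: "s\<^sup>2 = M\<^sup>2 - 4 * Q" and "0 \<le> s" unfolding s_def using disc by auto
  have "s < M"
    using \<open>0 < M\<close> \<open>0 < Q\<close> s2 by (intro power2_less_imp_less[of s M]) linarith+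
  then have "0 < \<rho>" unfolding \<rho>_def using \<open>0 < Q\<close> by simp
  have factor: "Q * x\<^sup>2 - M * x + 1 = Q * (\<rho> - x) * ((\<rho> - x) + s / Q)" for x
  proof -
    have "Q * (\<rho> - x) * ((\<rho> - x) + s / Q) = Q * x\<^sup>2 - M * x + (M\<^sup>2 - s\<^sup>2) / (4 * Q)"
      unfolding \<rho>_def using \<open>0 < Q\<close> by (simp add: field_simps power2_eq_square)
    then show ?thesis using s2 \<open>0 < Q\<close> by simp
  qed
  have root: "Q * \<rho>\<^sup>2 - M * \<rho> + 1 = 0" by (simp add: factor)
  have "2 * Q * \<rho> \<le> M" unfolding \<rho>_def using \<open>0 < Q\<close> \<open>0 \<le> s\<close> by simp
  then have "2 * Q * \<rho> * \<rho> \<le> M * \<rho>" using \<open>0 < \<rho>\<close> by simp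
  with root have "Q * \<rho>\<^sup>2 \<le> 1" by (simp add: power2_eq_square)
  have ratio: "\<rho> \<le> R i 0" for i
  proof (rule ccontr)
    assume less: "\<not> \<rho> \<le> R i 0"
    \<comment> \<open>For \<open>x \<le> R i 0\<close> both \<open>\<rho> - x\<close> and
      \<open>(\<rho> - x) + s / Q\<close> are at least \<open>\<rho> - R i 0\<close>.\<close>
    define \<delta> where "\<delta> = Q * (\<rho> - R i 0)\<^sup>2"
    have "0 < \<delta>" unfolding \<delta>_def using \<open>0 < Q\<close> less by simp
    moreover have "\<delta> \<le> Q * x\<^sup>2 - M * x + 1" if "x \<le> R i 0" for x
    proof -
      have "(\<rho> - R i 0) * (\<rho> - R i 0) \<le> (\<rho> - x) * ((\<rho> - x) + s / Q)"
        using less that divide_nonneg_pos[OF \<open>0 \<le> s\<close> \<open>0 < Q\<close>] by (intro mult_mono) linarith+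
      then show ?thesis
        unfolding factor \<delta>_def using \<open>0 < Q\<close> by (simp add: power2_eq_square)
    qed
    ultimately show False using no_uniform_descent[of "R i", OF R0 \<open>0 < Q\<close> R] by blast
  qed
  have "\<rho> * g j \<le> g (Suc j)" for j
    using ratio[of j] pos[of j] unfolding R_def by (simp add: pos_le_divide_eq)
  with \<open>0 < \<rho>\<close> root \<open>Q * \<rho>\<^sup>2 \<le> 1\<close> show ?thesis by (intro that)
qed

subsection \<open>The radial walk count\<close>

text \<open>\<open>radial p q t k\<close> counts the walks of length \<open>t\<close> from the root to a fixed vertex at distance
  \<open>k\<close> when the root has \<open>p + 1\<close> neighbours and the vertices at odd distance have \<open>q + 1\<close>.\<close>

fun radial :: "nat \<Rightarrow> nat \<Rightarrow> nat \<Rightarrow> nat \<Rightarrow> nat" where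
  "radial p q 0 k = (if k = 0 then 1 else 0)"
| "radial p q (Suc t) 0 = Suc p * radial p q t (Suc 0)"
| "radial p q (Suc t) (Suc k) =
     radial p q t k + (if even k then q else p) * radial p q t (Suc (Suc k))"

lemma radial_eq_0: "t < k \<Longrightarrow> radial p q t k = 0"
proof (induction t arbitrary: k)
  case (Suc t)
  then show ?case by (cases k) auto
qed simp

lemma radial_diag: "radial p q k k = 1"
  by (induction k) (auto simp: radial_eq_0)

text \<open>Away from the root the weights are an exact eigenfunction of the walk recursion with
  eigenvalue \<open>\<Lambda>\<close>; \<open>LA\<close> and \<open>LB\<close> are its two parities.
  At the root only an inequality remains, which is enough for induction on \<open>t\<close>.\<close>

lemma radial_le:
  fixes \<mu> :: real and p q t k :: nat
  assumes "1 \<le> \<mu>"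
  defines "\<Lambda> \<equiv> sqrt (\<mu>\<^sup>2 + p) * sqrt (\<mu>\<^sup>2 + q) / \<mu>"
  shows "radial p q t k * sqrt (\<mu>\<^sup>2 + p)
    \<le> \<Lambda> ^ t * (if even k then sqrt (\<mu>\<^sup>2 + p) else sqrt (\<mu>\<^sup>2 + q)) / \<mu> ^ k"
proof -
  define A B where "A = sqrt (\<mu>\<^sup>2 + p)" and "B = sqrt (\<mu>\<^sup>2 + q)"
  have \<mu>: "0 < \<mu>" "1 \<le> \<mu>\<^sup>2" using assms(1) by auto
  then have AB: "0 < A" "0 < B" "A\<^sup>2 = \<mu>\<^sup>2 + p" "B\<^sup>2 = \<mu>\<^sup>2 + q"
    unfolding A_def B_def by (auto simp: add_pos_nonneg)
  have \<Lambda>: "\<Lambda> = A * B / \<mu>" unfolding \<Lambda>_def A_def B_def ..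
  then have "0 < \<Lambda>" using \<mu> AB by simp
  have LA: "\<Lambda> * A = (\<mu> + p / \<mu>) * B"
  proof -
    have "\<Lambda> * A = A\<^sup>2 * B / \<mu>" unfolding \<Lambda> by (simp add: power2_eq_square)
    then show ?thesis unfolding AB using \<mu> by (simp add: field_simps power2_eq_square)
  qed
  have LB: "\<Lambda> * B = (\<mu> + q / \<mu>) * A"
  proof -
    have "\<Lambda> * B = B\<^sup>2 * A / \<mu>" unfolding \<Lambda> by (simp add: power2_eq_square)
    then show ?thesis unfolding AB using \<mu> by (simp add: field_simps power2_eq_square)
  qed
  have "radial p q t k * A \<le> \<Lambda> ^ t * (if even k then A else B) / \<mu> ^ k"
  proof (induction t arbitrary: k)
    case 0
    then show ?case using \<mu> AB by simp
  next
    case (Suc t)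
    show ?case
    proof (cases k)
      case 0
      have "radial p q (Suc t) 0 * A = (real p + 1) * (radial p q t (Suc 0) * A)"
        by (simp add: algebra_simps)
      also have "\<dots> \<le> (real p + 1) * (\<Lambda> ^ t * B / \<mu>)"
        using Suc[of "Suc 0"] by (intro mult_left_mono) auto
      also have "\<dots> = \<Lambda> ^ t * ((real p + 1) / \<mu> * B)" by simp
      \<comment> \<open>The root has \<open>p + 1\<close> children and no parent;
        \<open>1 \<le> \<mu>\<close> gives
        \<open>(p + 1) / \<mu> \<le> \<mu> + p / \<mu>\<close>.\<close>
      also have "\<dots> \<le> \<Lambda> ^ t * ((\<mu> + p / \<mu>) * B)"
        using \<mu> AB(2) \<open>0 < \<Lambda>\<close>
        by (intro mult_left_mono mult_right_mono) (auto simp: field_simps power2_eq_square)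
      also have "\<dots> = \<Lambda> ^ Suc t * A" by (simp add: LA[symmetric])
      finally show ?thesis using 0 by simp
    next
      case (Suc k')
      define n where "n = (if even k' then q else p)"
      define f where "f k = (if even k then A else B) / \<mu> ^ k" for k
      have "radial p q (Suc t) k * A = radial p q t k' * A + n * (radial p q t (Suc (Suc k')) * A)"
        unfolding Suc n_def by (simp add: algebra_simps)
      also have "\<dots> \<le> \<Lambda> ^ t * f k' + n * (\<Lambda> ^ t * f (Suc (Suc k')))"
        using Suc.IH[of k'] Suc.IH[of "Suc (Suc k')"] unfolding f_def
        by (intro add_mono mult_left_mono) auto
      also have "\<dots> = \<Lambda> ^ t * (f k' + n * f (Suc (Suc k')))" by (simp add: algebra_simps)
      also have "f k' + n * f (Suc (Suc k')) = (\<mu> + n / \<mu>) * (if even k' then A else B) / \<mu> ^ Suc k'"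
        unfolding f_def using \<mu> by (simp add: field_simps)
      also have "\<dots> = \<Lambda> * f (Suc k')"
        unfolding f_def n_def using LA LB by simp
      also have "\<Lambda> ^ t * (\<Lambda> * f (Suc k')) = \<Lambda> ^ Suc t * f k" unfolding Suc by simp
      finally show ?thesis unfolding f_def by simp
    qed
  qed
  then show ?thesis unfolding A_def B_def .
qed

text \<open>Prolonging walks by one step compares adjacent distances at the cost of a factor
  \<open>\<Lambda>\<close>. Convergence thus passes from \<open>k\<close> down to 0 and from there
  up to \<open>j\<close>; \<open>0 < p\<close> and \<open>0 < q\<close> keep the coefficient of the
  farther distance at least 1.\<close>

lemma summable_radial:
  fixes \<Lambda> :: real
  assumes "0 < \<Lambda>" "0 < p" "0 < q" and "summable (\<lambda>t. radial p q t k / \<Lambda> ^ t)"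
  shows "summable (\<lambda>t. radial p q t j / \<Lambda> ^ t)"
proof -
  have shift: "summable (\<lambda>t. radial p q t i / \<Lambda> ^ t)"
    if "summable (\<lambda>t. radial p q t i' / \<Lambda> ^ t)"
      and le: "\<And>t. radial p q t i \<le> radial p q (Suc t) i'" for i i'
  proof (rule summable_comparison_test')
    show "summable (\<lambda>t. \<Lambda> * (radial p q (Suc t) i' / \<Lambda> ^ Suc t))"
      by (intro summable_mult summable_Suc_iff[THEN iffD2] that(1))
    show "norm (radial p q t i / \<Lambda> ^ t) \<le> \<Lambda> * (radial p q (Suc t) i' / \<Lambda> ^ Suc t)" if "0 \<le> t" for t
      using le[of t] \<open>0 < \<Lambda>\<close> by (simp add: divide_right_mono del: radial.simps)
  qed
  have down: "summable (\<lambda>t. radial p q t i / \<Lambda> ^ t)"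
    if "summable (\<lambda>t. radial p q t (Suc i) / \<Lambda> ^ t)" for i
    by (rule shift[OF that]) simp
  have up: "summable (\<lambda>t. radial p q t (Suc i) / \<Lambda> ^ t)"
    if "summable (\<lambda>t. radial p q t i / \<Lambda> ^ t)" for i
    by (rule shift[OF that], cases i) (use assms in \<open>auto simp: trans_le_add2\<close>)
  have "summable (\<lambda>t. radial p q t 0 / \<Lambda> ^ t)"
    using assms(4) by (induction k) (auto dest: down)
  then show ?thesis by (induction j) (auto dest: up)
qed

text \<open>The Green function \<open>G k\<close> at \<open>1 / \<Lambda>\<close> satisfies a two-step recurrence whose coefficients do
  not depend on the parity of \<open>k\<close>.\<close>

lemma radial_green_lower:
  fixes \<Lambda> :: real
  assumes "0 < \<Lambda>" "0 < p" "0 < q" and "summable (\<lambda>t. radial p q t k\<^sub>0 / \<Lambda> ^ t)"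
  obtains \<mu> C :: real where "0 < \<mu>" and "real p * real q \<le> \<mu> ^ 4" and "\<Lambda>\<^sup>2 = \<mu>\<^sup>2 + real p + real q + real p * real q / \<mu>\<^sup>2"
    and "0 < C" and "\<And>k. C / \<mu> ^ k \<le> (\<Sum>t. radial p q t k / \<Lambda> ^ t)"
proof -
  define G where "G k = (\<Sum>t. radial p q t k / \<Lambda> ^ t)" for k
  have sm: "summable (\<lambda>t. radial p q t k / \<Lambda> ^ t)" for k
    using summable_radial[OF assms] .
  have Gpos: "0 < G k" for k
    unfolding G_def using \<open>0 < \<Lambda>\<close> radial_diag[of p q k] by (intro suminf_pos2[OF sm, of _ k]) auto
  define n where "n k = real (if even k then q else p)" for k :: nat
  have one: "\<Lambda> * G (Suc k) = G k + n k * G (Suc (Suc k))" for k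
  proof -
    \<comment> \<open>At positive distance the term for \<open>t = 0\<close> vanishes.\<close>
    have "G (Suc k) = (\<Sum>t. radial p q (Suc t) (Suc k) / \<Lambda> ^ Suc t)"
      unfolding G_def using suminf_split_head[OF sm[of "Suc k"]] by simp
    also have "\<dots> = (\<Sum>t. (1 / \<Lambda>) * (radial p q t k / \<Lambda> ^ t)
        + (n k / \<Lambda>) * (radial p q t (Suc (Suc k)) / \<Lambda> ^ t))"
      unfolding n_def by (intro arg_cong[of _ _ suminf] ext) (simp add: add_divide_distrib)
    also have "\<dots> = (1 / \<Lambda>) * G k + (n k / \<Lambda>) * G (Suc (Suc k))"
      unfolding G_def
      by (subst suminf_add[symmetric]) (intro summable_mult sm suminf_mult arg_cong2[of _ _ _ _ "(+)"])+
    finally show ?thesis using \<open>0 < \<Lambda>\<close> by (simp add: field_simps)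
  qed
  define M Q where "M = \<Lambda>\<^sup>2 - p - q" and "Q = real p * q"
  have "0 < Q" unfolding Q_def using assms by simp
  \<comment> \<open>Three uses of \<open>one\<close> leave the coefficients
    \<open>n k + n (k + 1) = p + q\<close> and \<open>n (k + 1) * n (k + 2) = Q\<close>, whatever
    the parity of \<open>k\<close>.\<close>
  have two: "G k + Q * G (k + 4) = M * G (k + 2)" for k
  proof -
    have "\<Lambda> * (\<Lambda> * G (k + 2)) = \<Lambda> * G (k + 1) + n (k + 1) * (\<Lambda> * G (k + 3))"
      using one[of "k + 1"] by (simp add: algebra_simps eval_nat_numeral)
    also have "\<dots> = (G k + n k * G (k + 2)) + n (k + 1) * (G (k + 2) + n (k + 2) * G (k + 4))"
      using one[of k] one[of "k + 2"] by (simp add: eval_nat_numeral)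
    also have "\<dots> = G k + (p + q) * G (k + 2) + Q * G (k + 4)"
      unfolding n_def Q_def by (simp add: algebra_simps)
    finally show ?thesis unfolding M_def by (simp add: algebra_simps power2_eq_square)
  qed
  \<comment> \<open>On each parity class, \<open>i = 0\<close> or \<open>i = 1\<close>,
    \<open>two\<close> is a three-term recurrence.\<close>
  have ex: "\<exists>\<rho>>0. Q * \<rho>\<^sup>2 - M * \<rho> + 1 = 0 \<and> Q * \<rho>\<^sup>2 \<le> 1 \<and> (\<forall>j. \<rho> * G (2 * j + i) \<le> G (2 * Suc j + i))" for i
  proof -
    have "G (2 * j + i) + Q * G (2 * (j + 2) + i) = M * G (2 * (j + 1) + i)" for j
      using two[of "2 * j + i"] by (simp add: algebra_simps eval_nat_numeral)
    then show ?thesis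
      by (rule positive_recurrence_growth[of "\<lambda>j. G (2 * j + i)", OF Gpos \<open>0 < Q\<close>]) blast
  qed
  obtain \<rho> where \<rho>: "0 < \<rho>" "Q * \<rho>\<^sup>2 - M * \<rho> + 1 = 0" "Q * \<rho>\<^sup>2 \<le> 1"
    and even: "\<And>j. \<rho> * G (2 * j) \<le> G (2 * Suc j)"
    using ex[of 0] by auto
  obtain \<sigma> where \<sigma>: "0 < \<sigma>" "Q * \<sigma>\<^sup>2 - M * \<sigma> + 1 = 0" "Q * \<sigma>\<^sup>2 \<le> 1"
    and odd: "\<And>j. \<sigma> * G (2 * j + 1) \<le> G (2 * Suc j + 1)"
    using ex[of 1] by auto
  \<comment> \<open>Both are the smaller root: the product of the roots is \<open>1 / Q\<close>.\<close>
  have "\<sigma> = \<rho>"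
  proof (rule ccontr)
    assume ne: "\<sigma> \<noteq> \<rho>"
    have "M * (\<rho> * \<sigma>) = (Q * \<rho>\<^sup>2 + 1) * \<sigma>" "M * (\<rho> * \<sigma>) = (Q * \<sigma>\<^sup>2 + 1) * \<rho>"
      using \<rho>(2) \<sigma>(2) by (simp_all add: algebra_simps)
    then have "(Q * \<rho>\<^sup>2 + 1) * \<sigma> = (Q * \<sigma>\<^sup>2 + 1) * \<rho>" by simp
    then have "(Q * (\<rho> * \<sigma>) - 1) * (\<rho> - \<sigma>) = 0" by (simp add: algebra_simps power2_eq_square)
    then have 1: "Q * (\<rho> * \<sigma>) = 1" using ne by simp
    have "Q * (\<rho> - \<sigma>)\<^sup>2 = Q * \<rho>\<^sup>2 + Q * \<sigma>\<^sup>2 - 2 * (Q * (\<rho> * \<sigma>))"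
      by (simp add: algebra_simps power2_eq_square)
    also have "\<dots> \<le> 0" using 1 \<rho>(3) \<sigma>(3) by simp
    finally show False using ne \<open>0 < Q\<close> by (simp add: mult_le_0_iff)
  qed
  \<comment> \<open>Two levels cost the factor \<open>\<rho>\<close>, so one level should cost
    \<open>1 / \<mu> = sqrt \<rho>\<close>.\<close>
  define \<mu> where "\<mu> = 1 / sqrt \<rho>"
  have \<mu>: "0 < \<mu>" "\<mu>\<^sup>2 = 1 / \<rho>" unfolding \<mu>_def using \<rho>(1) by (auto simp: power_divide)
  \<comment> \<open>Chosen to fit the two starting values \<open>k = 0\<close> and
    \<open>k = 1\<close>.\<close>
  define C where "C = min (G 0) (\<mu> * G 1)"
  have C: "0 < C" "C \<le> G 0" "C / \<mu> \<le> G 1"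
    unfolding C_def using Gpos \<mu>(1) by (auto simp: min_def field_simps)
  have step: "\<rho> * G k \<le> G (k + 2)" for k
    using even[of "k div 2"] odd[of "k div 2"] \<open>\<sigma> = \<rho>\<close>
    by (cases "even k") (auto elim!: evenE oddE)
  have "C / \<mu> ^ k \<le> G k" for k
  proof (induction k rule: nat_less_induct)
    case (1 k)
    consider "k = 0" | "k = 1" | k' where "k = k' + 2"
      by (metis add_2_eq_Suc' less_2_cases not_less_eq old.nat.exhaust One_nat_def)
    then show ?case
    proof cases
      case 3
      have "C / \<mu> ^ k = \<rho> * (C / \<mu> ^ k')"
        unfolding 3 power_add \<mu> using \<rho>(1) by simp
      also have "\<dots> \<le> \<rho> * G k'" using 1 3 \<rho>(1) by (intro mult_left_mono) auto
      also have "\<dots> \<le> G k" using step 3 by simp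
      finally show ?thesis .
    qed (use C in auto)
  qed
  moreover have "real p * real q \<le> \<mu> ^ 4"
  proof -
    have "\<mu> ^ 4 = (\<mu>\<^sup>2)\<^sup>2" by simp
    also have "\<dots> = 1 / \<rho>\<^sup>2" unfolding \<mu> by (simp add: power_divide)
    finally show ?thesis
      using \<rho>(1,3) unfolding Q_def by (simp add: pos_le_divide_eq)
  qed
  moreover have "\<Lambda>\<^sup>2 = \<mu>\<^sup>2 + real p + real q + real p * real q / \<mu>\<^sup>2"
  proof -
    have "M = 1 / \<rho> + Q * \<rho>" using \<rho>(1,2) by (simp add: field_simps power2_eq_square)
    then show ?thesis unfolding \<mu> M_def Q_def by simp
  qed
  ultimately show ?thesis using that[of \<mu> C] \<mu>(1) C(1) unfolding G_def by simp
qed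

subsection \<open>The cogrowth formula for radial sums\<close>

definition cogrowth_map :: "real \<Rightarrow> real \<Rightarrow> real \<Rightarrow> real" where
  "cogrowth_map p q \<mu> = sqrt (\<mu>\<^sup>2 + p + q + p * q / \<mu>\<^sup>2)"

text \<open>The factored form is the rate that occurs in \<open>radial_le\<close>.\<close>

lemma cogrowth_map_eq:
  assumes "0 < \<mu>"
  shows "cogrowth_map p q \<mu> = sqrt (\<mu>\<^sup>2 + p) * sqrt (\<mu>\<^sup>2 + q) / \<mu>"
proof -
  have "\<mu>\<^sup>2 + p + q + p * q / \<mu>\<^sup>2 = (\<mu>\<^sup>2 + p) * (\<mu>\<^sup>2 + q) / \<mu>\<^sup>2"
    using assms by (simp add: field_simps)
  then show ?thesis
    unfolding cogrowth_map_def using assms by (simp add: real_sqrt_mult real_sqrt_divide)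
qed

text \<open>Since \<open>p * q \<le> x\<^sup>2 * y\<^sup>2\<close>, the gain in the square outweighs
  the loss in \<open>p * q / \<mu>\<^sup>2\<close>.\<close>

lemma cogrowth_map_mono:
  assumes "0 < x" "x \<le> y" "p * q \<le> x ^ 4" "0 \<le> p" "0 \<le> q"
  shows "cogrowth_map p q x \<le> cogrowth_map p q y"
proof -
  have "p * q * (y\<^sup>2 - x\<^sup>2) \<le> x\<^sup>2 * y\<^sup>2 * (y\<^sup>2 - x\<^sup>2)"
  proof (rule mult_right_mono)
    have "x ^ 4 = x\<^sup>2 * x\<^sup>2" by simp
    also have "\<dots> \<le> x\<^sup>2 * y\<^sup>2" using assms by (intro mult_left_mono power_mono) auto
    finally show "p * q \<le> x\<^sup>2 * y\<^sup>2" using assms(3) by simp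
    show "0 \<le> y\<^sup>2 - x\<^sup>2" using assms by (simp add: power_mono)
  qed
  then have "(p * q * (y\<^sup>2 - x\<^sup>2)) / (x\<^sup>2 * y\<^sup>2) \<le> y\<^sup>2 - x\<^sup>2"
    using assms by (simp add: pos_divide_le_eq mult_ac)
  moreover have "(p * q * (y\<^sup>2 - x\<^sup>2)) / (x\<^sup>2 * y\<^sup>2) = p * q / x\<^sup>2 - p * q / y\<^sup>2"
    using assms by (simp add: field_simps)
  ultimately show ?thesis unfolding cogrowth_map_def by simp
qed

text \<open>At this point \<open>\<mu>\<^sup>2\<close> and \<open>p * q / \<mu>\<^sup>2\<close> both
  equal \<open>sqrt (p * q)\<close>, which completes the square.\<close>

lemma cogrowth_map_critical:
  assumes "0 < p" "0 < q"
  shows "cogrowth_map p q ((p * q) powr (1 / 4)) = sqrt p + sqrt q"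
proof -
  have "((p * q) powr (1 / 4))\<^sup>2 = sqrt (p * q)"
    using assms by (simp add: powr_power powr_half_sqrt)
  moreover have "p * q / sqrt (p * q) = sqrt (p * q)"
    using assms by (simp add: real_div_sqrt)
  ultimately have "cogrowth_map p q ((p * q) powr (1 / 4)) = sqrt ((sqrt p + sqrt q)\<^sup>2)"
    unfolding cogrowth_map_def using assms by (simp add: power2_sum real_sqrt_mult)
  then show ?thesis using assms by simp
qed

text \<open>The walk count for a set with \<open>a k\<close> elements at distance \<open>k\<close>;
  distances beyond \<open>t\<close> contribute nothing.\<close>

definition radial_sum :: "nat \<Rightarrow> nat \<Rightarrow> (nat \<Rightarrow> nat) \<Rightarrow> nat \<Rightarrow> nat" where
  "radial_sum p q a t = (\<Sum>k\<le>t. a k * radial p q t k)"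

lemma growth_rate_radial_sum_le:
  assumes "growth_rate a < ereal \<mu>" "1 \<le> \<mu>"
  shows "growth_rate (radial_sum p q a) \<le> ereal (cogrowth_map p q \<mu>)"
proof -
  \<comment> \<open>The room between \<open>m\<close> and \<open>\<mu>\<close> makes the sum over
    \<open>k\<close> a convergent geometric series.\<close>
  obtain m where m: "growth_rate a < ereal m" "m < \<mu>"
    using ereal_dense2[OF assms(1)] by auto
  have "0 < m" using m(1) growth_rate_nonneg[of a] by (metis ereal_less(2) le_less_trans)
  obtain K where K: "0 < K" "\<And>k. real (a k) \<le> K * m ^ k"
    using growth_rate_lessE[OF m(1)] by metis
  define \<Lambda> where "\<Lambda> = cogrowth_map p q \<mu>"
  have \<Lambda>: "\<Lambda> = sqrt (\<mu>\<^sup>2 + p) * sqrt (\<mu>\<^sup>2 + q) / \<mu>"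
    unfolding \<Lambda>_def using assms(2) by (simp add: cogrowth_map_eq)
  define A B where "A = sqrt (\<mu>\<^sup>2 + p)" and "B = sqrt (\<mu>\<^sup>2 + q)"
  have AB: "0 < A" "0 < B" unfolding A_def B_def using assms(2) by (auto intro: add_pos_nonneg)
  then have "0 < \<Lambda>" unfolding \<Lambda> A_def B_def using assms(2) by simp
  define D where "D = max A B"
  have D: "A \<le> D" "B \<le> D" unfolding D_def by auto
  define C where "C = D / A"
  have "0 < C" unfolding C_def using AB D by simp
  have rad: "radial p q t k \<le> C * \<Lambda> ^ t / \<mu> ^ k" for t k
  proof -
    have "radial p q t k * A \<le> \<Lambda> ^ t * (if even k then A else B) / \<mu> ^ k"
      using radial_le[OF assms(2), of p q t k] unfolding \<Lambda> A_def B_def .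
    also have "\<dots> \<le> \<Lambda> ^ t * D / \<mu> ^ k"
      using D \<open>0 < \<Lambda>\<close> assms(2) by (intro divide_right_mono mult_left_mono) auto
    finally have "radial p q t k \<le> \<Lambda> ^ t * D / \<mu> ^ k / A"
      using AB by (subst pos_le_divide_eq) auto
    then show ?thesis unfolding C_def by (simp add: mult_ac)
  qed
  have geo: "(\<Sum>k\<le>t. (m / \<mu>) ^ k) \<le> 1 / (1 - m / \<mu>)" for t
  proof -
    have "(\<Sum>k\<le>t. (m / \<mu>) ^ k) \<le> (\<Sum>k. (m / \<mu>) ^ k)"
      using m(2) \<open>0 < m\<close> by (intro sum_le_suminf summable_geometric) auto
    then show ?thesis using m(2) \<open>0 < m\<close> by (simp add: suminf_geometric)
  qed
  have "real (radial_sum p q a t) \<le> K * C / (1 - m / \<mu>) * \<Lambda> ^ t" for t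
  proof -
    have "real (radial_sum p q a t) = (\<Sum>k\<le>t. real (a k) * real (radial p q t k))"
      unfolding radial_sum_def by simp
    also have "\<dots> \<le> (\<Sum>k\<le>t. (K * m ^ k) * (C * \<Lambda> ^ t / \<mu> ^ k))"
      using K rad \<open>0 < m\<close> by (intro sum_mono mult_mono) auto
    also have "\<dots> = K * C * \<Lambda> ^ t * (\<Sum>k\<le>t. (m / \<mu>) ^ k)"
      unfolding sum_distrib_left by (simp add: power_divide mult_ac)
    also have "\<dots> \<le> K * C * \<Lambda> ^ t * (1 / (1 - m / \<mu>))"
      using K(1) \<open>0 < C\<close> \<open>0 < \<Lambda>\<close> by (intro mult_left_mono geo) auto
    finally show ?thesis by simp
  qed
  then show ?thesis using \<open>0 < \<Lambda>\<close> unfolding \<Lambda>_def by (rule growth_rate_le)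
qed

text \<open>Each single term is at most the whole sum. Summing over \<open>t\<close> bounds
  \<open>a k\<close> times the Green function uniformly in \<open>k\<close>, and the lower bound on
  the Green function turns this into \<open>a k = O(\<mu> ^ k)\<close>.\<close>

lemma growth_rate_radial_sum_lessE:
  assumes "growth_rate (radial_sum p q a) < ereal \<Lambda>" "0 < p" "0 < q" "0 < a k\<^sub>0"
  obtains \<mu> :: real where "0 < \<mu>" "real p * real q \<le> \<mu> ^ 4" "\<Lambda> = cogrowth_map p q \<mu>"
    "growth_rate a \<le> ereal \<mu>"
proof -
  obtain y where y: "growth_rate (radial_sum p q a) < ereal y" "y < \<Lambda>"
    using ereal_dense2[OF assms(1)] by auto
  have "0 < y" using y(1) growth_rate_nonneg by (metis ereal_less(2) le_less_trans)
  with y(2) have "0 < \<Lambda>" by simp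
  obtain K where K: "0 < K" "\<And>t. real (radial_sum p q a t) \<le> K * y ^ t"
    using growth_rate_lessE[OF y(1)] by metis
  have le: "real (a k) * (radial p q t k / \<Lambda> ^ t) \<le> K * (y / \<Lambda>) ^ t" for k t
  proof -
    have "a k * radial p q t k \<le> radial_sum p q a t"
    proof (cases "k \<le> t")
      case True
      then show ?thesis unfolding radial_sum_def by (intro member_le_sum) auto
    qed (simp add: radial_eq_0)
    then have "real (a k) * radial p q t k \<le> K * y ^ t"
      using K(2)[of t] by (metis of_nat_le_iff of_nat_mult order_trans)
    then show ?thesis using \<open>0 < \<Lambda>\<close> by (simp add: power_divide divide_right_mono)
  qed
  have geo: "summable (\<lambda>t. K * (y / \<Lambda>) ^ t)"
    using y(2) \<open>0 < y\<close> by (intro summable_mult summable_geometric) auto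
  \<comment> \<open>One non-empty level makes the Green function finite there, hence at every
    distance.\<close>
  have sm0: "summable (\<lambda>t. radial p q t k\<^sub>0 / \<Lambda> ^ t)"
  proof (rule summable_comparison_test'[OF geo])
    fix t :: nat
    have "1 * (radial p q t k\<^sub>0 / \<Lambda> ^ t) \<le> real (a k\<^sub>0) * (radial p q t k\<^sub>0 / \<Lambda> ^ t)"
      using assms(4) \<open>0 < \<Lambda>\<close> by (intro mult_right_mono) auto
    also note le
    finally show "norm (radial p q t k\<^sub>0 / \<Lambda> ^ t) \<le> K * (y / \<Lambda>) ^ t"
      using \<open>0 < \<Lambda>\<close> by simp
  qed
  obtain \<mu> C where \<mu>: "0 < \<mu>" "real p * real q \<le> \<mu> ^ 4" "\<Lambda>\<^sup>2 = \<mu>\<^sup>2 + real p + real q + real p * real q / \<mu>\<^sup>2"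
    and C: "0 < C" "\<And>k. C / \<mu> ^ k \<le> (\<Sum>t. radial p q t k / \<Lambda> ^ t)"
    by (rule radial_green_lower[OF \<open>0 < \<Lambda>\<close> assms(2,3) sm0]) (rule that)
  have "real (a k) \<le> (\<Sum>t. K * (y / \<Lambda>) ^ t) / C * \<mu> ^ k" for k
  proof -
    have sm: "summable (\<lambda>t. radial p q t k / \<Lambda> ^ t)"
      by (rule summable_radial) fact+
    have "real (a k) * (C / \<mu> ^ k) \<le> real (a k) * (\<Sum>t. radial p q t k / \<Lambda> ^ t)"
      by (intro mult_left_mono C(2)) simp
    also have "\<dots> = (\<Sum>t. real (a k) * (radial p q t k / \<Lambda> ^ t))"
      by (rule suminf_mult[OF sm, symmetric])
    also have "\<dots> \<le> (\<Sum>t. K * (y / \<Lambda>) ^ t)"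
      by (intro suminf_le le summable_mult sm geo)
    finally show ?thesis using C(1) \<mu>(1) by (simp add: field_simps)
  qed
  then have "growth_rate a \<le> ereal \<mu>" using \<mu>(1) by (rule growth_rate_le)
  moreover have "\<Lambda> = cogrowth_map p q \<mu>"
    unfolding cogrowth_map_def using \<mu>(3) \<open>0 < \<Lambda>\<close> by (simp add: real_sqrt_unique)
  ultimately show ?thesis using that \<mu> by blast
qed

theorem growth_rate_radial_sum:
  assumes "0 < p" "0 < q" "0 < a k\<^sub>0" "growth_rate a = ereal \<alpha>"
  shows "growth_rate (radial_sum p q a)
    = ereal (cogrowth_map p q (max \<alpha> ((real p * q) powr (1 / 4))))"
proof (rule antisym)
  define \<theta> where "\<theta> = (real p * q) powr (1 / 4)"
  have "1 \<le> p * q" using assms(1,2) by simp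
  then have pq: "1 \<le> real p * q" by (metis of_nat_1 of_nat_le_iff of_nat_mult)
  then have "1 \<le> \<theta>" unfolding \<theta>_def by (intro ge_one_powr_ge_zero) auto
  define m where "m = max \<alpha> \<theta>"
  have "1 \<le> m" unfolding m_def using \<open>1 \<le> \<theta>\<close> by simp
  have "\<theta> ^ 4 = real p * q"
  proof -
    have "\<theta> ^ 4 = \<theta> powr 4" using \<open>1 \<le> \<theta>\<close> by (subst powr_numeral) auto
    also have "\<dots> = (real p * q) powr 1" unfolding \<theta>_def by (subst powr_powr) simp
    finally show ?thesis using pq by (simp only: powr_one)
  qed
  then have m4: "real p * q \<le> m ^ 4"
    unfolding m_def using \<open>1 \<le> \<theta>\<close> power_mono[of \<theta> "max \<alpha> \<theta>" 4] by simp
  \<comment> \<open>The upper bound needs \<open>\<mu>\<close> strictly above the growth rate, so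
    \<open>m\<close> is approached from the right.\<close>
  have "isCont (cogrowth_map p q) m"
    unfolding cogrowth_map_def[abs_def] using \<open>1 \<le> m\<close> by (intro continuous_intros) auto
  then have "(cogrowth_map p q \<longlongrightarrow> cogrowth_map p q m) (at_right m)"
    unfolding isCont_def by (simp add: filterlim_at_split)
  then have lim: "((\<lambda>\<mu>. ereal (cogrowth_map p q \<mu>)) \<longlongrightarrow> ereal (cogrowth_map p q m)) (at_right m)"
    by simp
  have "growth_rate (radial_sum p q a) \<le> ereal (cogrowth_map p q \<mu>)" if "m < \<mu>" for \<mu>
    using that assms(4) \<open>1 \<le> m\<close> by (intro growth_rate_radial_sum_le) (auto simp: m_def)
  then have "growth_rate (radial_sum p q a) \<le> ereal (cogrowth_map p q m)"
    by (intro tendsto_lowerbound[OF lim] eventually_mono[OF eventually_at_right_less]) auto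
  then show "growth_rate (radial_sum p q a) \<le> ereal (cogrowth_map p q (max \<alpha> ((real p * q) powr (1 / 4))))"
    unfolding m_def \<theta>_def .
  \<comment> \<open>A value \<open>l\<close> strictly between the rate and the claim would be
    \<open>cogrowth_map p q \<mu>\<close> with \<open>m \<le> \<mu>\<close>, against
    monotonicity.\<close>
  have "ereal (cogrowth_map p q m) \<le> growth_rate (radial_sum p q a)"
  proof (rule ccontr)
    assume "\<not> ?thesis"
    then have "growth_rate (radial_sum p q a) < ereal (cogrowth_map p q m)" by simp
    from ereal_dense2[OF this]
    obtain l where l: "growth_rate (radial_sum p q a) < ereal l" "l < cogrowth_map p q m"
      by auto
    obtain \<mu> where \<mu>: "0 < \<mu>" "real p * real q \<le> \<mu> ^ 4" "l = cogrowth_map p q \<mu>" "growth_rate a \<le> ereal \<mu>"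
      by (rule growth_rate_radial_sum_lessE[where k\<^sub>0 = k\<^sub>0, OF l(1) assms(1-3)]) (rule that)
    have "\<theta> ^ 4 \<le> \<mu> ^ 4" using \<open>\<theta> ^ 4 = real p * q\<close> \<mu>(2) by simp
    then have "\<theta> \<le> \<mu>" using \<mu>(1) by (simp add: power_mono_iff \<theta>_def)
    then have "m \<le> \<mu>" unfolding m_def using \<mu>(4) assms(4) by simp
    then have "cogrowth_map p q m \<le> l"
      unfolding \<mu>(3) using m4 \<open>1 \<le> m\<close> by (intro cogrowth_map_mono) auto
    with l(2) show False by simp
  qed
  then show "ereal (cogrowth_map p q (max \<alpha> ((real p * q) powr (1 / 4)))) \<le> growth_rate (radial_sum p q a)"
    unfolding m_def \<theta>_def .
qed

subsection \<open>Levels of the rooted biregular tree\<close>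

locale rooted_biregular_tree =
  fixes c d :: nat and V :: "'a set" and E :: "('a \<times> 'a) set" and r :: 'a
  assumes cd: "2 \<le> c" "c < d"
    and tree: "biregular_tree c d V E"
    and root: "r \<in> V"
begin

text \<open>The degree at odd distance from the root, whichever of \<open>c\<close> and
  \<open>d\<close> the root has.\<close>

definition other_degree :: nat where
  "other_degree = c + d - graph_degree E r"

definition level :: "'a \<Rightarrow> nat" where
  "level v = (LEAST n. (r, v) \<in> E ^^ n)"

lemma graph_tree: "graph_tree V E"
  using tree unfolding biregular_tree_def by blast

lemma edge_in: "(u, v) \<in> E \<Longrightarrow> u \<in> V" "(u, v) \<in> E \<Longrightarrow> v \<in> V"
  using graph_tree unfolding graph_tree_def simple_graph_def by auto

lemma edge_sym: "(u, v) \<in> E \<Longrightarrow> (v, u) \<in> E"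
  using graph_tree unfolding graph_tree_def simple_graph_def by (auto dest: symD)

lemma no_cycle: "\<not> graph_cycle V E p"
  using graph_tree unfolding graph_tree_def by blast

lemma degree_cases: "v \<in> V \<Longrightarrow> graph_degree E v = c \<or> graph_degree E v = d"
  using tree unfolding biregular_tree_def by blast

lemma degree_pos: "v \<in> V \<Longrightarrow> 0 < graph_degree E v"
  using degree_cases[of v] cd by auto

lemma finite_neighbours: "v \<in> V \<Longrightarrow> finite (E `` {v})"
  using degree_pos[of v] unfolding graph_degree_def by (auto simp: card_gt_0_iff)

lemma degree_edge:
  assumes "(u, v) \<in> E"
  shows "graph_degree E v = c + d - graph_degree E u"
proof -
  have "v \<in> E `` {u}" using assms by blast
  then have "graph_degree E u = d \<Longrightarrow> graph_degree E v = c" "graph_degree E u = c \<Longrightarrow> graph_degree E v = d"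
    using tree edge_in(1)[OF assms] unfolding biregular_tree_def by blast+
  then show ?thesis using degree_cases[OF edge_in(1)[OF assms]] by auto
qed

lemma root_degrees: "{graph_degree E r, other_degree} = {c, d}"
  using degree_cases[OF root] cd unfolding other_degree_def by auto

lemma relpow_degree:
  assumes "(r, v) \<in> E ^^ n"
  shows "v \<in> V \<and> graph_degree E v = (if even n then graph_degree E r else other_degree)"
  using assms
proof (induction n arbitrary: v)
  case 0
  then show ?case using root by simp
next
  case (Suc n)
  then obtain u where u: "(r, u) \<in> E ^^ n" "(u, v) \<in> E" by auto
  then show ?case
    using Suc.IH[OF u(1)] degree_edge[OF u(2)] edge_in[OF u(2)] degree_cases[OF root] cd
    unfolding other_degree_def by auto
qed

text \<open>The degree of the endpoint reveals the parity of the number of steps, so bipartiteness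
  comes from the degrees and not from the absence of odd cycles.\<close>

lemma relpow_parity:
  assumes "(r, v) \<in> E ^^ m" "(r, v) \<in> E ^^ n"
  shows "even m \<longleftrightarrow> even n"
proof -
  have "graph_degree E r \<noteq> other_degree"
    using root_degrees cd by (auto simp: doubleton_eq_iff)
  then show ?thesis
    using relpow_degree[OF assms(1)] relpow_degree[OF assms(2)] by metis
qed

lemma walk_relpow:
  assumes "graph_walk V E p"
  shows "(hd p, last p) \<in> E ^^ (length p - 1)"
proof -
  have "p \<noteq> []" using assms unfolding graph_walk_def by blast
  then show ?thesis using assms
  proof (induction p rule: rev_nonempty_induct)
    case (snoc x xs)
    then have "graph_walk V E xs" "(last xs, x) \<in> E"
      unfolding graph_walk_def by (auto simp: successively_append_iff)
    then have "(hd xs, x) \<in> E ^^ Suc (length xs - 1)"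
      using snoc.IH relpow_Suc_I by metis
    then show ?case using snoc by (simp del: relpow.simps)
  qed (auto simp: graph_walk_def)
qed

lemma reachable: "v \<in> V \<Longrightarrow> \<exists>n. (r, v) \<in> E ^^ n"
  using graph_tree root walk_relpow unfolding graph_tree_def graph_connected_def by metis

lemma level_relpow: "v \<in> V \<Longrightarrow> (r, v) \<in> E ^^ level v"
  unfolding level_def using reachable by (auto intro: LeastI_ex)

lemma level_le: "(r, v) \<in> E ^^ n \<Longrightarrow> level v \<le> n"
  unfolding level_def by (rule Least_le)

lemma level_root: "level r = 0"
  using level_le[of r 0] by simp

lemma level_0: "v \<in> V \<Longrightarrow> level v = 0 \<Longrightarrow> v = r"
  using level_relpow[of v] by simp

lemma degree_level:
  "v \<in> V \<Longrightarrow> graph_degree E v = (if even (level v) then graph_degree E r else other_degree)"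
  using relpow_degree level_relpow by blast

text \<open>Since \<open>c \<noteq> d\<close>, degrees separate even levels from odd ones.\<close>

lemma level_edge:
  assumes "(u, v) \<in> E"
  shows "level v = Suc (level u) \<or> level u = Suc (level v)"
proof -
  have "(r, v) \<in> E ^^ Suc (level u)" "(r, u) \<in> E ^^ Suc (level v)"
    using assms edge_sym edge_in[OF assms] level_relpow by auto
  then show ?thesis
    using level_le relpow_parity[of v "Suc (level u)" "level v"] level_relpow edge_in[OF assms]
    by (smt (verit) even_Suc le_Suc_eq not_less_eq_eq Suc_n_not_le_n le_antisym)
qed

lemma parent_exists:
  assumes "v \<in> V" "level v = Suc k"
  obtains u where "(u, v) \<in> E" "level u = k"
proof -
  have "(r, v) \<in> E ^^ Suc k" using level_relpow assms by metis
  then obtain u where u: "(r, u) \<in> E ^^ k" "(u, v) \<in> E" by auto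
  have "level u = k"
    using level_le[OF u(1)] level_edge[OF u(2)] assms by linarith
  with u show ?thesis using that by blast
qed

text \<open>Two vertices of the same level are joined by a path through lower levels, so a common child
  would close a cycle.\<close>

lemma path_below:
  assumes "u \<in> V" "v \<in> V" "u \<noteq> v" "level u = k" "level v = k"
  shows "\<exists>p. graph_walk V E p \<and> distinct p \<and> hd p = u \<and> last p = v \<and> (\<forall>w\<in>set p. level w \<le> k)"
  using assms
proof (induction k arbitrary: u v)
  case 0
  then show ?case using level_0 by metis
next
  case (Suc k)
  obtain u' v' where par: "(u', u) \<in> E" "level u' = k" "(v', v) \<in> E" "level v' = k"
    using parent_exists Suc.prems by metis
  have "\<exists>p. graph_walk V E p \<and> distinct p \<and> hd p = u' \<and> last p = v' \<and> (\<forall>w\<in>set p. level w \<le> k)"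
  proof (cases "u' = v'")
    case True
    then show ?thesis
      using par edge_in by (intro exI[of _ "[u']"]) (auto simp: graph_walk_def)
  next
    case False
    then show ?thesis using Suc.IH par edge_in by blast
  qed
  then obtain p where p: "graph_walk V E p" "distinct p" "hd p = u'" "last p = v'"
    "\<forall>w\<in>set p. level w \<le> k" by blast
  have "p \<noteq> []" using p(1) unfolding graph_walk_def by blast
  have "graph_walk V E (u # p @ [v])"
    using p par edge_sym[OF par(1)] edge_in \<open>p \<noteq> []\<close> unfolding graph_walk_def
    by (auto simp: successively_append_iff successively_Cons)
  \<comment> \<open>\<open>p\<close> stays on levels up to \<open>k\<close>, while \<open>u\<close>
    and \<open>v\<close> lie on level \<open>Suc k\<close>.\<close>
  moreover have "distinct (u # p @ [v])"
    using p(2,5) Suc.prems by fastforce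
  ultimately show ?case
    using p(5) Suc.prems by (intro exI[of _ "u # p @ [v]"]) (auto intro: le_SucI)
qed

lemma parent_unique:
  assumes "(u, w) \<in> E" "(v, w) \<in> E" "level u = k" "level v = k" "level w = Suc k"
  shows "u = v"
proof (rule ccontr)
  assume "u \<noteq> v"
  then obtain p where p: "graph_walk V E p" "distinct p" "hd p = u" "last p = v"
    "\<forall>x\<in>set p. level x \<le> k"
    using path_below assms edge_in by metis
  have "p \<noteq> []" using p(1) unfolding graph_walk_def by blast
  have "2 \<le> length p"
    using p(3,4) \<open>u \<noteq> v\<close> \<open>p \<noteq> []\<close> by (cases p; cases "tl p") auto
  then have "graph_cycle V E (w # p)"
    using p assms edge_sym edge_in \<open>p \<noteq> []\<close> unfolding graph_cycle_def graph_walk_def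
    by (auto simp: successively_Cons)
  then show False using no_cycle by blast
qed

section \<open>Counting walks to a fixed vertex\<close>

definition walks :: "nat \<Rightarrow> 'a \<Rightarrow> 'a list set" where
  "walks t v = {p. graph_walk V E p \<and> length p = t + 1 \<and> hd p = r \<and> last p = v}"

lemma walks_0: "walks 0 v = (if v = r then {[r]} else {})"
proof -
  have "p \<in> walks 0 v \<longleftrightarrow> p = [r] \<and> v = r" for p
    using root unfolding walks_def graph_walk_def by (cases p) auto
  then show ?thesis by auto
qed

lemma walks_Suc:
  "v \<in> V \<Longrightarrow> walks (Suc t) v = (\<Union>u\<in>E `` {v}. (\<lambda>p. p @ [v]) ` walks t u)"
proof (intro set_eqI iffI)
  fix p assume v: "v \<in> V" and "p \<in> walks (Suc t) v"
  then have p: "graph_walk V E p" "length p = t + 2" "hd p = r" "last p = v"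
    unfolding walks_def by auto
  obtain q where q: "p = q @ [v]" "length q = t + 1" "q \<noteq> []"
    using p by (cases p rule: rev_cases) force+
  then have "q \<in> walks t (last q)" "(last q, v) \<in> E"
    using p unfolding walks_def graph_walk_def by (auto simp: successively_append_iff)
  then show "p \<in> (\<Union>u\<in>E `` {v}. (\<lambda>p. p @ [v]) ` walks t u)"
    using q(1) edge_sym by blast
next
  fix p assume v: "v \<in> V" and "p \<in> (\<Union>u\<in>E `` {v}. (\<lambda>p. p @ [v]) ` walks t u)"
  then obtain u q where "(u, v) \<in> E" "q \<in> walks t u" "p = q @ [v]"
    using edge_sym by blast
  then show "p \<in> walks (Suc t) v"
    using v unfolding walks_def graph_walk_def by (auto simp: successively_append_iff)
qed

lemma finite_walks: "v \<in> V \<Longrightarrow> finite (walks t v)"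
proof (induction t arbitrary: v)
  case (Suc t)
  then show ?case
    unfolding walks_Suc[OF Suc.prems]
    by (intro finite_UN_I finite_imageI finite_neighbours) (auto dest: edge_in)
qed (simp add: walks_0)

lemma card_walks_Suc:
  assumes "v \<in> V"
  shows "card (walks (Suc t) v) = (\<Sum>u\<in>E `` {v}. card (walks t u))"
proof -
  have "card (walks (Suc t) v) = (\<Sum>u\<in>E `` {v}. card ((\<lambda>p. p @ [v]) ` walks t u))"
    unfolding walks_Suc[OF assms] using assms finite_walks finite_neighbours edge_in
    by (intro card_UN_disjoint) (auto simp: walks_def)
  also have "\<dots> = (\<Sum>u\<in>E `` {v}. card (walks t u))"
    by (intro sum.cong card_image) (auto simp: inj_on_def)
  finally show ?thesis .
qed

text \<open>The last step comes from the unique parent or from one of the remaining neighbours, all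
  of them children. This is the recursion of \<open>radial\<close>.\<close>

lemma card_walks:
  "v \<in> V \<Longrightarrow> card (walks t v) = radial (graph_degree E r - 1) (other_degree - 1) t (level v)"
proof (induction t arbitrary: v)
  case 0
  then show ?case using level_root level_0 by (auto simp: walks_0)
next
  case (Suc t)
  let ?W = "radial (graph_degree E r - 1) (other_degree - 1)"
  have sum: "card (walks (Suc t) v) = (\<Sum>u\<in>E `` {v}. ?W t (level u))"
    unfolding card_walks_Suc[OF Suc.prems] using Suc.IH edge_in by (intro sum.cong) auto
  show ?case
  proof (cases "level v")
    case 0
    then have "card (walks (Suc t) v) = (\<Sum>u\<in>E `` {v}. ?W t (Suc 0))"
      unfolding sum by (intro sum.cong) (auto dest: level_edge)
    also have "\<dots> = graph_degree E r * ?W t (Suc 0)"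
      using level_0[OF Suc.prems 0] by (simp add: graph_degree_def)
    finally show ?thesis using 0 degree_pos[OF root] by simp
  next
    case (Suc k)
    obtain u where u: "(u, v) \<in> E" "level u = k"
      using parent_exists[OF Suc.prems Suc] .
    have fin: "finite (E `` {v})" and mem: "u \<in> E `` {v}"
      using finite_neighbours[OF Suc.prems] edge_sym[OF u(1)] by auto
    have "level w = Suc (Suc k)" if "w \<in> E `` {v} - {u}" for w
      using that level_edge[of v w] parent_unique[of w v u k] edge_sym[of v w] u Suc by auto
    then have "card (walks (Suc t) v) = ?W t k + (\<Sum>w\<in>E `` {v} - {u}. ?W t (Suc (Suc k)))"
      unfolding sum sum.remove[OF fin mem] using u(2) by simp
    also have "\<dots> = ?W t k + (graph_degree E v - 1) * ?W t (Suc (Suc k))"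
      using fin mem by (simp add: graph_degree_def)
    finally show ?thesis using degree_level[OF Suc.prems] Suc by (simp split: if_splits)
  qed
qed

section \<open>Spheres and the decomposition of the walk count\<close>

definition sphere :: "'a set \<Rightarrow> nat \<Rightarrow> 'a set" where
  "sphere S k = {v \<in> S. level v = k}"

lemma sphere_Suc_subset: "sphere V (Suc k) \<subseteq> (\<Union>u\<in>sphere V k. E `` {u})"
proof
  fix v assume "v \<in> sphere V (Suc k)"
  then have "v \<in> V" "level v = Suc k" unfolding sphere_def by auto
  then obtain u where "(u, v) \<in> E" "level u = k" using parent_exists by metis
  then show "v \<in> (\<Union>u\<in>sphere V k. E `` {u})"
    using edge_in unfolding sphere_def by blast
qed

text \<open>A crude bound, enough to make the rate of the non-backtracking count a real
  number.\<close>

lemma sphere_growth: "finite (sphere V k) \<and> card (sphere V k) \<le> d ^ k"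
proof (induction k)
  case 0
  have "sphere V 0 = {r}" using level_0 level_root root unfolding sphere_def by auto
  then show ?case by simp
next
  case (Suc k)
  have fin: "finite (\<Union>u\<in>sphere V k. E `` {u})"
    using Suc finite_neighbours unfolding sphere_def by auto
  have "card (sphere V (Suc k)) \<le> card (\<Union>u\<in>sphere V k. E `` {u})"
    by (intro card_mono fin sphere_Suc_subset)
  also have "\<dots> \<le> (\<Sum>u\<in>sphere V k. card (E `` {u}))"
    using Suc by (intro card_UN_le) blast
  also have "\<dots> \<le> (\<Sum>u\<in>sphere V k. d)"
    using degree_cases cd unfolding graph_degree_def sphere_def
    by (intro sum_mono) fastforce
  also have "\<dots> \<le> d ^ Suc k" using Suc by simp
  finally show ?case using finite_subset[OF sphere_Suc_subset fin] by blast
qed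

lemma finite_sphere: "S \<subseteq> V \<Longrightarrow> finite (sphere S k)"
  using sphere_growth[of k] by (auto simp: sphere_def elim: rev_finite_subset)

lemma card_sphere_le: "S \<subseteq> V \<Longrightarrow> card (sphere S k) \<le> d ^ k"
  using sphere_growth[of k] by (auto simp: sphere_def intro: order_trans[OF card_mono])

lemma walk_count_eq:
  assumes "S \<subseteq> V"
  shows "walk_count V E r S t =
    (\<Sum>k\<le>t. card (sphere S k) * radial (graph_degree E r - 1) (other_degree - 1) t k)"
proof -
  let ?W = "radial (graph_degree E r - 1) (other_degree - 1)"
  have lev: "level v \<le> t" if "p \<in> walks t v" for p v
    using walk_relpow[of p] level_le that unfolding walks_def by auto
  have "{p. graph_walk V E p \<and> length p = t + 1 \<and> hd p = r \<and> last p \<in> S}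
      = (\<Union>k\<in>{..t}. \<Union>v\<in>sphere S k. walks t v)"
    using lev by (auto simp: walks_def sphere_def)
  then have "walk_count V E r S t = card (\<Union>k\<in>{..t}. \<Union>v\<in>sphere S k. walks t v)"
    unfolding walk_count_def by simp
  also have "\<dots> = (\<Sum>k\<le>t. card (\<Union>v\<in>sphere S k. walks t v))"
    using finite_sphere[OF assms] finite_walks assms
    by (intro card_UN_disjoint) (auto simp: sphere_def walks_def subset_iff)
  also have "\<dots> = (\<Sum>k\<le>t. \<Sum>v\<in>sphere S k. card (walks t v))"
    using finite_sphere[OF assms] finite_walks assms
    by (intro sum.cong refl card_UN_disjoint) (auto simp: sphere_def walks_def subset_iff)
  also have "\<dots> = (\<Sum>k\<le>t. \<Sum>v\<in>sphere S k. ?W t k)"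
    using assms by (intro sum.cong refl) (auto simp: card_walks sphere_def)
  finally show ?thesis by simp
qed

section \<open>Non-backtracking walks and spheres\<close>

lemma nonbacktracking_level:
  assumes "graph_walk V E p" "nonbacktracking p" "hd p = r"
  shows "i < length p \<Longrightarrow> level (p ! i) = i"
proof (induction i rule: nat_less_induct)
  case (1 i)
  have edge: "(p ! j, p ! Suc j) \<in> E" if "Suc j < length p" for j
    using assms(1) that unfolding graph_walk_def by (auto simp: successively_conv_nth)
  have "p \<noteq> []" using assms(1) unfolding graph_walk_def by blast
  then have p0: "level (p ! 0) = 0" using assms(3) level_root by (simp add: hd_conv_nth)
  consider "i = 0" | "i = 1" | j where "i = Suc (Suc j)"
    by (metis One_nat_def old.nat.exhaust)
  then show ?case
  proof cases
    case 2
    then show ?thesis using level_edge[OF edge[of 0]] p0 1 by auto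
  next
    case 3
    have lev: "level (p ! j) = j" "level (p ! Suc j) = Suc j" using 1 3 by auto
    have "p ! j \<noteq> p ! i" using assms(2) 1 3 unfolding nonbacktracking_def by auto
    \<comment> \<open>A step down would lead to the unique parent, which is the vertex just
      left.\<close>
    moreover have "p ! j = p ! i" if "level (p ! i) = j"
      using parent_unique[of "p ! j" "p ! Suc j" "p ! i" j] lev that edge[of j] edge[of "Suc j"]
        edge_sym 1 3 by auto
    ultimately show ?thesis using level_edge[OF edge[of "Suc j"]] lev 1 3 by auto
  qed (use p0 in auto)
qed

definition nb_walks :: "nat \<Rightarrow> 'a list set" where
  "nb_walks t = {p. graph_walk V E p \<and> nonbacktracking p \<and> length p = t + 1 \<and> hd p = r}"

lemma last_nb_walk: "p \<in> nb_walks t \<Longrightarrow> last p = p ! t"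
  unfolding nb_walks_def by (subst last_conv_nth) auto

lemma level_nb_walk: "p \<in> nb_walks t \<Longrightarrow> i \<le> t \<Longrightarrow> level (p ! i) = i"
  using nonbacktracking_level[of p i] unfolding nb_walks_def by simp

text \<open>Read backwards from the common end, each vertex is the unique parent of its
  successor.\<close>

lemma inj_on_last_nb_walks: "inj_on last (nb_walks t)"
proof (rule inj_onI)
  fix p q assume pq: "p \<in> nb_walks t" "q \<in> nb_walks t" "last p = last q"
  have edge: "(w ! j, w ! Suc j) \<in> E" if "w \<in> nb_walks t" "j < t" for w j
    using that unfolding nb_walks_def graph_walk_def by (auto simp: successively_conv_nth)
  have "p ! i = q ! i" if "i \<le> t" for i
    using that
  proof (induction i rule: inc_induct)
    case base
    then show ?case using pq last_nb_walk by metis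
  next
    case (step i)
    show ?case
    proof (rule parent_unique)
      show "(p ! i, p ! Suc i) \<in> E" "(q ! i, p ! Suc i) \<in> E"
        using edge[OF pq(1), of i] edge[OF pq(2), of i] step by simp_all
      show "level (p ! i) = i" "level (q ! i) = i" "level (p ! Suc i) = Suc i"
        using level_nb_walk[OF pq(1), of i] level_nb_walk[OF pq(2), of i]
          level_nb_walk[OF pq(1), of "Suc i"] step by simp_all
    qed
  qed
  then show "p = q" using pq by (intro nth_equalityI) (auto simp: nb_walks_def)
qed

lemma nb_walk_exists: "v \<in> V \<Longrightarrow> level v = t \<Longrightarrow> \<exists>p\<in>nb_walks t. last p = v"
proof (induction t arbitrary: v)
  case 0
  then show ?case using root level_0
    by (intro bexI[of _ "[r]"]) (auto simp: nb_walks_def graph_walk_def nonbacktracking_def)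
next
  case (Suc t)
  obtain u where u: "(u, v) \<in> E" "level u = t" using parent_exists[OF Suc.prems] .
  then obtain p where p: "p \<in> nb_walks t" "last p = u" using Suc.IH edge_in by blast
  \<comment> \<open>\<open>v\<close> lies on a higher level than every vertex of
    \<open>p\<close>.\<close>
  have "p ! i \<noteq> v" if "i \<le> t" for i
    using level_nb_walk[OF p(1) that] that Suc.prems by auto
  then have "nonbacktracking (p @ [v])"
    using p(1) unfolding nb_walks_def nonbacktracking_def by (auto simp: nth_append)
  then show ?case
    using p u Suc.prems unfolding nb_walks_def graph_walk_def
    by (intro bexI[of _ "p @ [v]"]) (auto simp: successively_append_iff)
qed

lemma nb_walk_count_eq:
  assumes "S \<subseteq> V"
  shows "nb_walk_count V E r S t = card (sphere S t)"
proof -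
  have "bij_betw last {p \<in> nb_walks t. last p \<in> S} (sphere S t)"
    unfolding bij_betw_def
  proof
    show "inj_on last {p \<in> nb_walks t. last p \<in> S}"
      using inj_on_last_nb_walks by (rule inj_on_subset) auto
    show "last ` {p \<in> nb_walks t. last p \<in> S} = sphere S t"
    proof (intro subset_antisym subsetI)
      fix v assume "v \<in> last ` {p \<in> nb_walks t. last p \<in> S}"
      then show "v \<in> sphere S t"
        using last_nb_walk level_nb_walk[of _ t t] unfolding sphere_def by force
    next
      fix v assume "v \<in> sphere S t"
      then show "v \<in> last ` {p \<in> nb_walks t. last p \<in> S}"
        using nb_walk_exists[of v t] assms unfolding sphere_def by blast
    qed
  qed
  then show ?thesis
    unfolding nb_walk_count_def nb_walks_def by (auto dest: bij_betw_same_card simp: conj_ac)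
qed

end

section \<open>The cogrowth formula for the biregular tree\<close>

theorem theorem1p7:
  fixes c d :: nat and V :: "'a set" and E :: "('a \<times> 'a) set" and r :: 'a and S :: "'a set"
  assumes "2 \<le> c" and "c < d"
    and "biregular_tree c d V E"
    and "r \<in> V"
    and "S \<noteq> {}" and "S \<subseteq> V"
  shows "\<exists>\<alpha> \<beta> :: real.
    growth_rate (nb_walk_count V E r S) = ereal \<alpha> \<and>
    growth_rate (walk_count V E r S) = ereal \<beta> \<and>
    (\<alpha> \<le> ((real c - 1) * (real d - 1)) powr (1 / 4) \<longrightarrow>
       \<beta> = sqrt (real c - 1) + sqrt (real d - 1)) \<and>
    (\<alpha> \<ge> ((real c - 1) * (real d - 1)) powr (1 / 4) \<longrightarrow>
       \<beta> = sqrt (\<alpha>\<^sup>2 + real c + real d - 2 + (real c - 1) * (real d - 1) / \<alpha>\<^sup>2))"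
proof -
  interpret rooted_biregular_tree c d V E r
    using assms by unfold_locales
  define p q where "p = graph_degree E r - 1" and "q = other_degree - 1"
  \<comment> \<open>The root may have either degree; the formula is symmetric in \<open>p\<close>
    and \<open>q\<close>.\<close>
  have pq: "real p = real c - 1 \<and> real q = real d - 1 \<or> real p = real d - 1 \<and> real q = real c - 1"
    using root_degrees assms(1,2) unfolding p_def q_def by (auto simp: doubleton_eq_iff of_nat_diff)
  then have pos: "0 < p" "0 < q" using assms(1,2) by auto
  define \<theta> where "\<theta> = ((real c - 1) * (real d - 1)) powr (1 / 4)"
  have \<theta>: "\<theta> = (real p * q) powr (1 / 4)" unfolding \<theta>_def using pq by (auto simp: mult.commute)
  have "growth_rate (nb_walk_count V E r S) \<le> ereal d"
    using card_sphere_le[OF assms(6)] assms(2)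
    by (intro growth_rate_le[of _ 1]) (simp_all add: nb_walk_count_eq[OF assms(6)] flip: of_nat_power)
  then obtain \<alpha> where \<alpha>: "growth_rate (nb_walk_count V E r S) = ereal \<alpha>"
    using growth_rate_nonneg[of "nb_walk_count V E r S"]
    by (cases "growth_rate (nb_walk_count V E r S)") auto
  obtain v where "v \<in> S" using assms(5) by blast
  then have "0 < nb_walk_count V E r S (level v)"
    unfolding nb_walk_count_eq[OF assms(6)] using finite_sphere[OF assms(6)]
    by (auto simp: card_gt_0_iff sphere_def)
  moreover have "walk_count V E r S = radial_sum p q (nb_walk_count V E r S)"
    unfolding radial_sum_def p_def q_def
    by (intro ext) (simp add: walk_count_eq[OF assms(6)] nb_walk_count_eq[OF assms(6)])
  ultimately have "growth_rate (walk_count V E r S) = ereal (cogrowth_map p q (max \<alpha> \<theta>))"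
    using growth_rate_radial_sum[OF pos _ \<alpha>] unfolding \<theta> by simp
  moreover have "cogrowth_map p q (max \<alpha> \<theta>) = sqrt (real c - 1) + sqrt (real d - 1)" if "\<alpha> \<le> \<theta>"
    using cogrowth_map_critical[of p q] pos pq that unfolding \<theta>
    by (auto simp: max_absorb2 add.commute)
  moreover have "real p * real q = (real c - 1) * (real d - 1)"
    and "\<alpha>\<^sup>2 + real p + real q = \<alpha>\<^sup>2 + real c + real d - 2"
    using pq by auto
  then have "cogrowth_map p q (max \<alpha> \<theta>)
      = sqrt (\<alpha>\<^sup>2 + real c + real d - 2 + (real c - 1) * (real d - 1) / \<alpha>\<^sup>2)" if "\<theta> \<le> \<alpha>"
    using that unfolding cogrowth_map_def by (simp only: max_absorb1)
  ultimately show ?thesis using \<alpha> unfolding \<theta>_def by blast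
qed

end
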